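(* Let $m\in\mathbb{N}^+$. Let $G_1=(\{p_j\},\{\bm\mu_j\},\{\bm\Sigma_j\})_{j=1}^n$ be a Gaussian mixture on $\mathbb{R}^m$ with $\bm\Sigma_j=\bm S_j^{\mathrm T}\bm S_j$ for invertible matrices $\bm S_j\in M_m(\mathbb{R})$, and let $G_2=(\{p'_k\},\{\bm\mu'_k\},\{\bm\Sigma'_k\})_{k=1}^{n'}$ be a Gaussian mixture on $\mathbb{R}^m$ with positive definite covariances $\bm\Sigma'_k$. Let $L=S_2^2(G_1,G_2)$, regarded as a function of $\bm\mu_1,\dots,\bm\mu_n$ and $\bm S_1,\dots,\bm S_n$ (with $\{p_j\}$ and $G_2$ fixed). Then for every $j=1,\dots,n$, $$\left\|\nabla_{\bm\mu_j}L\right\|\le 4B_{m-1},\qquad \left\|\nabla_{\bm S_j}L\right\|_F\le 4B_{m-1},$$ where $B_{m-1}=2\pi^{m/2}/\Gamma(m/2)$, $\|\cdot\|$ is the Euclidean norm and $\|\bm A\|_F=\sqrt{\operatorname{tr}(\bm A^{\mathrm T}\bm A)}$ is the Frobenius norm.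
   Context: A Gaussian mixture on $\mathbb{R}^m$, $G=(\{p_j\},\{\bm\mu_j\},\{\bm\Sigma_j\})_{j=1}^n$, has $p_j\ge0$, $\sum_jp_j=1$, $\bm\mu_j\in\mathbb{R}^m$, covariance matrices $\bm\Sigma_j$, and is the distribution $\sum_jp_j\mathcal N(\bm\mu_j,\bm\Sigma_j)$. For unit $\bm\nu$, the projection $\langle G,\bm\nu\rangle$ (law of $\bm X^{\mathrm T}\bm\nu$, $\bm X\sim G$) is the univariate mixture $\sum_jp_j\mathcal N(\bm\mu_j^{\mathrm T}\bm\nu,\bm\nu^{\mathrm T}\bm\Sigma_j\bm\nu)$. For univariate distributions with CDFs $F,F'$, $C_2^2=\int_{\mathbb{R}}|F-F'|^2dx$. $S_2^2(G_1,G_2)=\int_{\mathbb{S}^{m-1}}C_2^2(\langle G_1,\bm\nu\rangle,\langle G_2,\bm\nu\rangle)\,d\bm\nu$, with $d\bm\nu$ the surface measure on the unit sphere $\mathbb{S}^{m-1}$. *)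

theory Defs
  imports "HOL-Probability.Probability"
begin

definition gauss_cdf :: "real \<Rightarrow> real \<Rightarrow> real \<Rightarrow> real" where
  "gauss_cdf mu v x = cdf (density lborel (normal_density mu (sqrt v))) x"

definition proj_mixture_cdf ::
  "(nat \<Rightarrow> real) \<Rightarrow> (nat \<Rightarrow> real^'m) \<Rightarrow> (nat \<Rightarrow> real^'m^'m) \<Rightarrow> nat \<Rightarrow> real^'m \<Rightarrow> real \<Rightarrow> real"
  where
  "proj_mixture_cdf p mu Sg n nu x =
     (\<Sum>j<n. p j * gauss_cdf (mu j \<bullet> nu) (nu \<bullet> (Sg j *v nu)) x)"

definition C2sq :: "(real \<Rightarrow> real) \<Rightarrow> (real \<Rightarrow> real) \<Rightarrow> real" where
  "C2sq F F' = (LINT x|lborel. (F x - F' x)^2)"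

text \<open>Integral over the unit sphere w.r.t. surface measure, via the cone (polar) construction:
  sigma(A) = m * lambda({t x | x in A, 0 < t <= 1}), so that
  int_{S^{m-1}} f dsigma = m * int_{unit ball} f(x/|x|) dx.\<close>
definition sphere_integral :: "(real^'m \<Rightarrow> real) \<Rightarrow> real" where
  "sphere_integral f = real CARD('m) * (LINT x:ball 0 1|lborel. f (x /\<^sub>R norm x))"

definition S2sq ::
  "(nat \<Rightarrow> real) \<Rightarrow> (nat \<Rightarrow> real^'m) \<Rightarrow> (nat \<Rightarrow> real^'m^'m) \<Rightarrow> nat \<Rightarrow>
   (nat \<Rightarrow> real) \<Rightarrow> (nat \<Rightarrow> real^'m) \<Rightarrow> (nat \<Rightarrow> real^'m^'m) \<Rightarrow> nat \<Rightarrow> real" where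
  "S2sq p mu Sg n p' mu' Sg' n' =
     sphere_integral (\<lambda>nu. C2sq (proj_mixture_cdf p mu Sg n nu) (proj_mixture_cdf p' mu' Sg' n' nu))"

definition sphere_area :: "nat \<Rightarrow> real" where
  "sphere_area m = 2 * pi powr (real m / 2) / Gamma (real m / 2)"

end

theory Submission
  imports Defs
begin

text \<open>Write \<open>D\<close> for the difference of the two projected CDFs in direction \<open>nu\<close>, where component \<open>j\<close>
  projects to a normal law with mean \<open>u\<close> and standard deviation \<open>s\<close>. Differentiating \<open>D\<^sup>2\<close> under
  the integral gives \<open>- 2 p\<^sub>j E[D(u + s Z)]\<close> for the derivative of the squared Cramer distance in
  \<open>u\<close> and \<open>- 2 p\<^sub>j E[Z D(u + s Z)]\<close> for the one in \<open>s\<close>, with \<open>Z\<close> standard normal. As \<open>|D| \<le> 1\<close> and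
  \<open>E|Z| \<le> 1\<close>, both are bounded by \<open>2 p\<^sub>j\<close>. Since \<open>u = mu\<^sub>j \<bullet> nu\<close> and \<open>s = norm (S\<^sub>j *v nu)\<close> are
  1-Lipschitz in \<open>mu\<^sub>j\<close> and \<open>S\<^sub>j\<close> for unit \<open>nu\<close>, the distance is \<open>2 p\<^sub>j\<close>-Lipschitz uniformly in \<open>nu\<close>.
  This dominates the difference quotients on the sphere, so differentiation passes through the
  outer integral, and the gradient of the integral is at most \<open>2 p\<^sub>j\<close> times the sphere area.\<close>

subsection \<open>Dominated differentiation under the integral sign\<close>

text \<open>Along a ray from \<open>a\<close> the one-sided difference quotients are at most
  \<open>K * norm h\<close>, hence so is their limit \<open>g \<bullet> h\<close>; testing with
  \<open>h = g\<close> bounds the norm. Comparing with the value at the centre \<open>a\<close> is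
  enough for this.\<close>

lemma norm_gradient_le_Lipschitz:
  fixes f :: "'a::euclidean_space \<Rightarrow> real"
  assumes der: "(f has_derivative (\<lambda>h. g \<bullet> h)) (at a)"
    and "\<delta> > 0"
    and lip: "\<And>y. y \<in> ball a \<delta> \<Longrightarrow> \<bar>f y - f a\<bar> \<le> K * norm (y - a)"
  shows "norm g \<le> K"
proof -
  have "g \<bullet> h \<le> K * norm h" for h
  proof -
    have "((\<lambda>t. f (a + t *\<^sub>R h)) has_derivative (\<lambda>t. g \<bullet> (t *\<^sub>R h))) (at 0)"
      by (rule has_derivative_compose[of "\<lambda>t. a + t *\<^sub>R h" _ _ _ f])
        (use der in \<open>auto intro!: derivative_eq_intros\<close>)
    then have "((\<lambda>t. f (a + t *\<^sub>R h)) has_real_derivative g \<bullet> h) (at 0)"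
      by (simp add: has_field_derivative_def mult_commute_abs)
    then have lim: "((\<lambda>t. (f (a + t *\<^sub>R h) - f a) / t) \<longlongrightarrow> g \<bullet> h) (at_right 0)"
      by (auto simp: DERIV_def intro: tendsto_mono[OF at_le])
    have "((\<lambda>t. norm (t *\<^sub>R h)) \<longlongrightarrow> norm (0 *\<^sub>R h)) (at_right (0::real))"
      by (intro tendsto_intros)
    then have "\<forall>\<^sub>F t in at_right (0::real). norm (t *\<^sub>R h) < \<delta>"
      using \<open>\<delta> > 0\<close> by (intro order_tendstoD) auto
    moreover have "\<forall>\<^sub>F t in at_right (0::real). t > 0"
      by (simp add: eventually_at_right_less)
    ultimately have "\<forall>\<^sub>F t in at_right 0. (f (a + t *\<^sub>R h) - f a) / t \<le> K * norm h"
    proof eventually_elim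
      case (elim t)
      then have "\<bar>f (a + t *\<^sub>R h) - f a\<bar> \<le> K * (t * norm h)"
        using lip[of "a + t *\<^sub>R h"] by (simp add: dist_norm)
      with elim show ?case by (simp add: divide_simps mult_ac)
    qed
    with lim show ?thesis by (intro tendsto_upperbound) auto
  qed
  from this[of g] have *: "norm g * norm g \<le> K * norm g"
    by (simp add: power2_norm_eq_inner power2_eq_square[symmetric])
  \<comment> \<open>The case \<open>g = 0\<close> still requires \<open>K \<ge> 0\<close>, which
    follows from the Lipschitz bound at a point of the ball other than \<open>a\<close>.\<close>
  obtain b :: 'a where b: "b \<in> Basis" using nonempty_Basis by blast
  then have "a + (\<delta>/2) *\<^sub>R b \<in> ball a \<delta>" using \<open>\<delta> > 0\<close> by (simp add: dist_norm)
  from order_trans[OF abs_ge_zero lip[OF this]] b \<open>\<delta> > 0\<close> have "0 \<le> K * (\<delta>/2)" by simp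
  then have "0 \<le> K" using \<open>\<delta> > 0\<close> by (simp add: zero_le_mult_iff)
  with * show ?thesis by (cases "g = 0") auto
qed

text \<open>The remainder quotients of the integrand are dominated by \<open>2 * K\<close>: one
  \<open>K\<close> for the increment of \<open>f\<close>, the other for its linear part, since
  \<open>norm_gradient_le_Lipschitz\<close> bounds the gradient by the same \<open>K\<close>.
  Dominated convergence along every sequence of increments tending to 0 then gives the Frechet
  derivative.\<close>

lemma has_derivative_integral_dominated:
  fixes f :: "'a::euclidean_space \<Rightarrow> 'b \<Rightarrow> real"
  assumes "\<delta> > 0"
    and meas: "\<And>y. y \<in> ball a \<delta> \<Longrightarrow> f y \<in> borel_measurable M"
    and int: "integrable M (f a)"
    and g: "g \<in> borel_measurable M"
    and der: "AE w in M. ((\<lambda>y. f y w) has_derivative (\<lambda>h. g w \<bullet> h)) (at a)"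
    and lip: "AE w in M. \<forall>y\<in>ball a \<delta>. \<bar>f y w - f a w\<bar> \<le> K w * norm (y - a)"
    and K: "integrable M K"
  shows "integrable M g"
    and "\<And>y. y \<in> ball a \<delta> \<Longrightarrow> integrable M (f y)"
    and "((\<lambda>y. LINT w|M. f y w) has_derivative (\<lambda>h. (LINT w|M. g w) \<bullet> h)) (at a)"
    and "norm (LINT w|M. g w) \<le> (LINT w|M. K w)"
proof -
  have gK: "AE w in M. norm (g w) \<le> K w"
    using der lip
  proof eventually_elim
    case (elim w)
    show ?case
      by (rule norm_gradient_le_Lipschitz[OF elim(1) \<open>\<delta> > 0\<close>]) (use elim(2) in auto)
  qed
  show ig: "integrable M g"
    by (rule Bochner_Integration.integrable_bound[OF K g]) (use gK in \<open>eventually_elim; simp\<close>)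
  show "norm (LINT w|M. g w) \<le> (LINT w|M. K w)"
    using integral_norm_bound[of M g]
      integral_mono_AE[OF integrable_norm[OF ig] K gK] by linarith
  show iF: "integrable M (f y)" if y: "y \<in> ball a \<delta>" for y
  proof -
    have "integrable M (\<lambda>w. f y w - f a w)"
    proof (rule Bochner_Integration.integrable_bound)
      show "integrable M (\<lambda>w. K w * norm (y - a))" using K by simp
      show "(\<lambda>w. f y w - f a w) \<in> borel_measurable M"
        using meas[OF y] int by measurable
      show "AE w in M. norm (f y w - f a w) \<le> norm (K w * norm (y - a))"
        using lip by eventually_elim (use y in fastforce)
    qed
    from Bochner_Integration.integrable_add[OF this int] show ?thesis by simp
  qed
  let ?r = "\<lambda>h. \<bar>(LINT w|M. f (a + h) w) - (LINT w|M. f a w) - (LINT w|M. g w) \<bullet> h\<bar> / norm h"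
  have "?r \<midarrow>0\<rightarrow> 0"
    unfolding tendsto_at_iff_sequentially comp_def
  proof (intro allI impI)
    fix X :: "nat \<Rightarrow> 'a"
    assume nz: "\<forall>i. X i \<in> UNIV - {0}" and X: "X \<longlonglongrightarrow> 0"
    from tendstoD[OF X \<open>\<delta> > 0\<close>] obtain N where N: "\<And>n. n \<ge> N \<Longrightarrow> norm (X n) < \<delta>"
      by (auto simp: eventually_sequentially)
    \<comment> \<open>Measurability and domination are available only inside the ball, so the first
      \<open>N\<close> increments are dropped.\<close>
    define Y where "Y n = X (n + N)" for n
    have Y0: "Y n \<noteq> 0" and Yb: "a + Y n \<in> ball a \<delta>" for n
      using nz N[of "n + N"] by (auto simp: Y_def dist_norm)
    have Y: "Y \<longlonglongrightarrow> 0" unfolding Y_def using X by (rule LIMSEQ_ignore_initial_segment)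
    define q where "q n w = (f (a + Y n) w - f a w - g w \<bullet> Y n) / norm (Y n)" for n w
    have "(\<lambda>n. LINT w|M. q n w) \<longlonglongrightarrow> (LINT w|M. 0)"
    proof (rule integral_dominated_convergence[where w = "\<lambda>w. 2 * K w"])
      show "q n \<in> borel_measurable M" for n
        unfolding q_def using meas[OF Yb] int g by measurable
      show "integrable M (\<lambda>w. 2 * K w)" using K by simp
      show "AE w in M. (\<lambda>n. q n w) \<longlonglongrightarrow> 0"
        using der
      proof eventually_elim
        case (elim w)
        then have "((\<lambda>h. norm (f (a + h) w - f a w - g w \<bullet> h) / norm h) \<longlongrightarrow> 0) (at 0)"
          by (simp add: has_derivative_at)
        then have "(\<lambda>n. norm (f (a + Y n) w - f a w - g w \<bullet> Y n) / norm (Y n)) \<longlonglongrightarrow> 0"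
          using Y Y0 unfolding tendsto_at_iff_sequentially comp_def by auto
        then show ?case
          by (intro tendsto_norm_zero_cancel[of "\<lambda>n. q n w"]) (simp add: q_def)
      qed
      show "AE w in M. norm (q n w) \<le> 2 * K w" for n
        using lip gK
      proof eventually_elim
        case (elim w)
        have "\<bar>f (a + Y n) w - f a w\<bar> \<le> K w * norm (Y n)" using elim(1) Yb[of n] by force
        moreover have "\<bar>g w \<bullet> Y n\<bar> \<le> K w * norm (Y n)"
          using Cauchy_Schwarz_ineq2[of "g w" "Y n"] elim(2)
          by (meson mult_right_mono norm_ge_zero order_trans)
        ultimately have "\<bar>f (a + Y n) w - f a w - g w \<bullet> Y n\<bar> \<le> 2 * K w * norm (Y n)" by linarith
        then show ?case using Y0[of n] by (simp add: q_def divide_simps)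
      qed
    qed simp
    moreover have "(LINT w|M. q n w)
        = ((LINT w|M. f (a + Y n) w) - (LINT w|M. f a w) - (LINT w|M. g w) \<bullet> Y n) / norm (Y n)" for n
      unfolding q_def using iF[OF Yb[of n]] int ig by simp
    ultimately have "(\<lambda>n. ?r (Y n)) \<longlonglongrightarrow> 0"
      using tendsto_rabs_zero[of "\<lambda>n. LINT w|M. q n w"] by simp
    then show "(\<lambda>n. ?r (X n)) \<longlonglongrightarrow> 0" unfolding Y_def by (rule LIMSEQ_offset)
  qed
  then show "((\<lambda>y. LINT w|M. f y w) has_derivative (\<lambda>h. (LINT w|M. g w) \<bullet> h)) (at a)"
    by (simp add: has_derivative_at bounded_linear_inner_right)
qed

text \<open>The gradient of the integrand need not be given: it is almost everywhere a limit of
  difference quotients and therefore measurable.\<close>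

lemma differentiable_integral_dominated:
  fixes f :: "'a::euclidean_space \<Rightarrow> 'b \<Rightarrow> real"
  assumes "\<delta> > 0"
    and meas: "\<And>y. y \<in> ball a \<delta> \<Longrightarrow> f y \<in> borel_measurable M"
    and int: "integrable M (f a)"
    and der: "AE w in M. (\<lambda>y. f y w) differentiable (at a)"
    and lip: "AE w in M. \<forall>y\<in>ball a \<delta>. \<bar>f y w - f a w\<bar> \<le> K w * norm (y - a)"
    and K: "integrable M K"
  shows "\<exists>g. ((\<lambda>y. LINT w|M. f y w) has_derivative (\<lambda>h. g \<bullet> h)) (at a)
    \<and> norm g \<le> (LINT w|M. K w)"
proof -
  \<comment> \<open>The offset 2 keeps \<open>t n\<close> strictly below \<open>\<delta>\<close>
    already at \<open>n = 0\<close>, so that all sample points lie in the open ball.\<close>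
  define t where "t n = \<delta> / real (n + 2)" for n
  have t: "t n > 0" "t n < \<delta>" for n using \<open>\<delta> > 0\<close> by (simp_all add: t_def field_simps add_pos_nonneg)
  have "(\<lambda>n. \<delta> / real n) \<longlonglongrightarrow> 0" by (rule lim_const_over_n)
  then have t0: "t \<longlonglongrightarrow> 0" unfolding t_def by (rule LIMSEQ_ignore_initial_segment)
  \<comment> \<open>Where the quotients do not converge, \<open>lim\<close> is an unspecified value;
    this concerns only a null set of \<open>w\<close>.\<close>
  define D where "D w b = lim (\<lambda>n. (f (a + t n *\<^sub>R b) w - f a w) / t n)" for w b
  define g where "g w = (\<Sum>b\<in>Basis. D w b *\<^sub>R b)" for w
  have "(\<lambda>w. D w b) \<in> borel_measurable M" if "b \<in> Basis" for b
  proof -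
    have "f (a + t n *\<^sub>R b) \<in> borel_measurable M" for n
      using meas t[of n] that by (simp add: dist_norm)
    then show ?thesis
      unfolding D_def using borel_measurable_integrable[OF int]
      by (intro borel_measurable_lim_metric borel_measurable_divide borel_measurable_diff) auto
  qed
  then have g: "g \<in> borel_measurable M" unfolding g_def
    by (intro borel_measurable_sum borel_measurable_scaleR) auto
  have "AE w in M. ((\<lambda>y. f y w) has_derivative (\<lambda>h. g w \<bullet> h)) (at a)"
    using der
  proof eventually_elim
    case (elim w)
    then obtain F where F: "((\<lambda>y. f y w) has_derivative F) (at a)" by (auto simp: differentiable_def)
    then have "linear F" by (rule has_derivative_linear)
    have "D w b = F b" if "b \<in> Basis" for b
    proof -
      have "((\<lambda>s. f (a + s *\<^sub>R b) w) has_derivative (\<lambda>s. F (s *\<^sub>R b))) (at 0)"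
        by (rule has_derivative_compose[of "\<lambda>s. a + s *\<^sub>R b" _ _ _ "\<lambda>y. f y w"])
          (use F in \<open>auto intro!: derivative_eq_intros\<close>)
      then have "((\<lambda>s. f (a + s *\<^sub>R b) w) has_real_derivative F b) (at 0)"
        by (simp add: has_field_derivative_def linear_cmul[OF \<open>linear F\<close>] mult_commute_abs)
      then have "((\<lambda>s. (f (a + s *\<^sub>R b) w - f a w) / s) \<longlongrightarrow> F b) (at 0)"
        by (simp add: DERIV_def)
      then have "(\<lambda>n. (f (a + t n *\<^sub>R b) w - f a w) / t n) \<longlonglongrightarrow> F b"
        by (rule filterlim_compose) (use t0 t(1) in \<open>simp add: filterlim_at less_imp_neq[symmetric]\<close>)
      then show ?thesis unfolding D_def by (rule limI)
    qed
    then have "g w \<bullet> h = (\<Sum>b\<in>Basis. (h \<bullet> b) * F b)" for h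
      by (simp add: g_def inner_sum_left inner_commute[of h] mult.commute)
    also have "(\<Sum>b\<in>Basis. (h \<bullet> b) * F b) = F (\<Sum>b\<in>Basis. (h \<bullet> b) *\<^sub>R b)" for h
      by (simp add: linear_sum[OF \<open>linear F\<close>] linear_cmul[OF \<open>linear F\<close>])
    finally have "g w \<bullet> h = F h" for h
      by (simp add: euclidean_representation)
    with F show ?case by simp
  qed
  from has_derivative_integral_dominated[OF \<open>\<delta> > 0\<close> meas int g this lip K]
  show ?thesis by blast
qed

subsection \<open>Gaussian distribution functions\<close>

lemma gauss_cdf_eq_integral:
  "gauss_cdf u v x = (LINT y|lborel. normal_density u (sqrt v) y * indicator {..x} y)"
proof -
  let ?M = "density lborel (normal_density u (sqrt v))"
  have "measure ?M {..x} = (LINT y|?M. indicator {..x} y)" by simp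
  also have "\<dots> = (LINT y|lborel. normal_density u (sqrt v) y * indicator {..x} y)"
    by (subst integral_density) auto
  finally show ?thesis by (simp add: gauss_cdf_def cdf_def)
qed

text \<open>Mean, variance and argument vary together: the first two depend on the direction and
  \<open>C2sq\<close> integrates over the third, so joint measurability is required.\<close>

lemma gauss_cdf_measurable [measurable (raw)]:
  assumes [measurable]: "u \<in> borel_measurable M" "v \<in> borel_measurable M" "x \<in> borel_measurable M"
  shows "(\<lambda>w. gauss_cdf (u w) (v w) (x w)) \<in> borel_measurable M"
  unfolding gauss_cdf_eq_integral normal_density_def indicator_def atMost_iff by measurable

lemma gauss_cdf_nonneg: "0 \<le> gauss_cdf u v x"
  by (simp add: gauss_cdf_def cdf_def)

lemma gauss_cdf_le_1:
  assumes "v > 0"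
  shows "gauss_cdf u v x \<le> 1"
proof -
  interpret prob_space "density lborel (normal_density u (sqrt v))"
    using assms by (intro prob_space_normal_density) simp
  show ?thesis by (simp add: gauss_cdf_def cdf_def)
qed

lemma normal_density_affine_std:
  assumes "s > 0"
  shows "s * normal_density u s (u + s * z) = std_normal_density z"
proof -
  have "sqrt (2 * pi * s\<^sup>2) = s * sqrt (2 * pi)"
    using assms by (simp add: real_sqrt_mult)
  then show ?thesis using assms
    by (simp add: normal_density_def power_mult_distrib)
qed

text \<open>Substituting \<open>y = u + s * z\<close> moves both parameters into the argument.
  Derivatives in \<open>u\<close> and in \<open>s\<close> then come from one fixed function by the
  chain rule.\<close>

lemma gauss_cdf_standardize:
  assumes "s > 0"
  shows "gauss_cdf u (s\<^sup>2) x = gauss_cdf 0 1 ((x - u) / s)"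
proof -
  have ind: "indicator {..x} (u + s * z) = (indicator {..(x - u) / s} z :: real)" for z
    using assms by (auto simp: indicator_def field_simps)
  have "gauss_cdf u (s\<^sup>2) x = (LINT y|lborel. normal_density u s y * indicator {..x} y)"
    using assms by (simp add: gauss_cdf_eq_integral)
  also have "\<dots> = \<bar>s\<bar> *\<^sub>R (LINT z|lborel. normal_density u s (u + s * z) * indicator {..x} (u + s * z))"
    using assms by (intro lborel_integral_real_affine) simp
  also have "\<dots> = (LINT z|lborel. (s * normal_density u s (u + s * z)) * indicator {..x} (u + s * z))"
    using assms by (simp add: mult.assoc)
  also have "\<dots> = gauss_cdf 0 1 ((x - u) / s)"
    by (simp add: normal_density_affine_std[OF assms] ind gauss_cdf_eq_integral)
  finally show ?thesis .
qed

lemma DERIV_std_gauss_cdf: "(gauss_cdf 0 1 has_real_derivative std_normal_density x) (at x)"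
proof -
  let ?d = "std_normal_density"
  have cont: "continuous_on A ?d" for A
    unfolding std_normal_density_def by (intro continuous_intros) auto
  \<comment> \<open>With this base point, the fundamental theorem of calculus is applied on
    \<open>{x-1..x+1}\<close>, where \<open>x\<close> is interior.\<close>
  define a where "a = x - 1"
  have eq: "gauss_cdf 0 1 y = gauss_cdf 0 1 a + integral {a..y} ?d" if "y \<ge> a" for y
  proof -
    have i: "integrable lborel (\<lambda>z. ?d z * indicator A z)" if "A \<in> sets lborel" for A
      by (rule integrable_real_mult_indicator) (use that in auto)
    have "gauss_cdf 0 1 y = (LINT z|lborel. ?d z * indicator {..a} z + ?d z * indicator {a<..y} z)"
      unfolding gauss_cdf_eq_integral using that
      by (intro Bochner_Integration.integral_cong) (auto simp: indicator_def)
    also have "\<dots> = gauss_cdf 0 1 a + (LINT z:{a<..y}|lborel. ?d z)"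
      by (subst Bochner_Integration.integral_add)
        (simp_all add: i gauss_cdf_eq_integral set_lebesgue_integral_def mult.commute[of "indicator _ _"])
    also have "(LINT z:{a<..y}|lborel. ?d z) = (LINT z:{a..y}|lborel. ?d z)"
      unfolding set_lebesgue_integral_def
      by (intro integral_cong_AE)
        (use AE_lborel_singleton[of a] in \<open>auto elim!: eventually_mono simp: indicator_def\<close>)
    also have "\<dots> = integral {a..y} ?d"
      by (intro set_borel_integral_eq_integral(2))
        (use i[of "{a..y}"] in \<open>simp add: set_integrable_def mult.commute[of "std_normal_density _"]\<close>)
    finally show ?thesis .
  qed
  have "((\<lambda>y. integral {a..y} ?d) has_real_derivative ?d x) (at x within {a..x+1})"
    by (rule integral_has_real_derivative) (auto simp: cont a_def)
  then have "((\<lambda>y. integral {a..y} ?d) has_real_derivative ?d x) (at x)"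
    by (subst (asm) at_within_interior) (auto simp: a_def)
  then have "((\<lambda>y. gauss_cdf 0 1 a + integral {a..y} ?d) has_real_derivative ?d x) (at x)"
    by (auto intro!: derivative_eq_intros)
  then show ?thesis
  proof (rule has_field_derivative_transform_within[where d = 1])
    fix y assume "dist y x < 1"
    then have "y \<ge> a" by (simp add: a_def dist_real_def)
    from eq[OF this] show "gauss_cdf 0 1 a + integral {a..y} ?d = gauss_cdf 0 1 y" by (rule sym)
  qed auto
qed

text \<open>Expand \<open>1 + y\<^sup>2 = (y - u)\<^sup>2 + 2 * u * (y - u) + (1 +
  u\<^sup>2)\<close> and use the central moments of order 0, 1 and 2.\<close>

lemma has_bochner_integral_normal_second_moment:
  assumes "s > 0"
  shows "has_bochner_integral lborel (\<lambda>y. normal_density u s y * (1 + y\<^sup>2)) (1 + u\<^sup>2 + s\<^sup>2)"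
proof -
  note m = normal_moment_even[OF assms, of u 0] normal_moment_odd[OF assms, of u 0]
    normal_moment_even[OF assms, of u 1]
  have "has_bochner_integral lborel
      (\<lambda>y. normal_density u s y * (y - u)\<^sup>2 + 2 * u * (normal_density u s y * (y - u))
        + (1 + u\<^sup>2) * normal_density u s y) (s\<^sup>2 + 2 * u * 0 + (1 + u\<^sup>2) * 1)"
    using m by (intro has_bochner_integral_add has_bochner_integral_mult_right)
      (auto simp: fact_numeral)
  moreover have "(\<lambda>y. normal_density u s y * (y - u)\<^sup>2 + 2 * u * (normal_density u s y * (y - u))
        + (1 + u\<^sup>2) * normal_density u s y) = (\<lambda>y. normal_density u s y * (1 + y\<^sup>2))"
    by (auto simp: power2_eq_square algebra_simps)
  ultimately show ?thesis by (simp add: add_ac)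
qed

text \<open>Chebyshev's inequality on either tail.\<close>

lemma gauss_cdf_tail_bound:
  assumes "v > 0"
  shows "\<bar>gauss_cdf u v x - indicator {0..} x\<bar> \<le> (1 + u\<^sup>2 + v) / (1 + x\<^sup>2)"
proof -
  let ?s = "sqrt v"
  have s: "?s > 0" "?s\<^sup>2 = v" using assms by auto
  note mom = has_bochner_integral_normal_second_moment[OF s(1), of u, unfolded s(2)]
  have pos: "1 + x\<^sup>2 > 0" by (smt (verit) zero_le_power2)
  \<comment> \<open>On \<open>A\<close> the weight \<open>(1 + y\<^sup>2) / (1 + x\<^sup>2)\<close>
    is at least 1. Using \<open>1 + x\<^sup>2\<close> in place of \<open>x\<^sup>2\<close> makes the
    bound integrable over the whole line.\<close>
  have bound: "(LINT y|lborel. normal_density u ?s y * indicator A y) \<le> (1 + u\<^sup>2 + v) / (1 + x\<^sup>2)"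
    if "A \<in> sets lborel" and A: "\<And>y. y \<in> A \<Longrightarrow> x\<^sup>2 \<le> y\<^sup>2" for A
  proof -
    have "(LINT y|lborel. normal_density u ?s y * indicator A y)
        \<le> (LINT y|lborel. normal_density u ?s y * (1 + y\<^sup>2) / (1 + x\<^sup>2))"
    proof (rule integral_mono)
      show "integrable lborel (\<lambda>y. normal_density u ?s y * indicator A y)"
        by (rule integrable_real_mult_indicator) (use that s in auto)
      show "integrable lborel (\<lambda>y. normal_density u ?s y * (1 + y\<^sup>2) / (1 + x\<^sup>2))"
        using mom by (intro integrable_divide) (rule integrable.intros)
      fix y
      have "indicator A y \<le> (1 + y\<^sup>2) / (1 + x\<^sup>2)"
        using A[of y] pos by (auto simp: indicator_def le_divide_eq)
      then show "normal_density u ?s y * indicator A y \<le> normal_density u ?s y * (1 + y\<^sup>2) / (1 + x\<^sup>2)"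
        using mult_left_mono[of _ _ "normal_density u ?s y"] by fastforce
    qed
    also have "\<dots> = (1 + u\<^sup>2 + v) / (1 + x\<^sup>2)"
      using has_bochner_integral_integral_eq[OF mom] by simp
    finally show ?thesis .
  qed
  show ?thesis
  proof (cases "x \<ge> 0")
    case False
    with bound[of "{..x}"] show ?thesis
      using gauss_cdf_nonneg[of u v x]
      by (simp add: gauss_cdf_eq_integral abs_le_square_iff[symmetric])
  next
    case True
    \<comment> \<open>For \<open>x \<ge> 0\<close> the distance to the step function is the mass of
      the right tail \<open>{x<..}\<close>, obtained as a complement.\<close>
    have "gauss_cdf u v x + (LINT y|lborel. normal_density u ?s y * indicator {x<..} y)
      = (LINT y|lborel. normal_density u ?s y * indicator {..x} y + normal_density u ?s y * indicator {x<..} y)"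
      unfolding gauss_cdf_eq_integral using s
      by (intro Bochner_Integration.integral_add[symmetric] integrable_real_mult_indicator) auto
    also have "\<dots> = (LINT y|lborel. normal_density u ?s y)"
      by (intro Bochner_Integration.integral_cong) (auto simp: indicator_def)
    also have "\<dots> = 1" using s by simp
    finally show ?thesis
      using bound[of "{x<..}"] True gauss_cdf_le_1[OF assms, of u x]
      by (simp add: abs_le_square_iff[symmetric])
  qed
qed

text \<open>The positive half-line and its reflection cover everything except the null set
  \<open>{0}\<close>.\<close>

lemma integrable_inverse_1_plus_square: "integrable lborel (\<lambda>x::real. 1 / (1 + x\<^sup>2))"
proof -
  have "set_integrable lborel {0<..} (\<lambda>x::real. inverse (1 + x\<^sup>2))"
    using integrable_I0i_1_div_plus_square by (simp add: interval_lebesgue_integrable_def einterval_def greaterThan_def divide_inverse)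
  then have i: "integrable lborel (\<lambda>x::real. indicator {0<..} x * (1 / (1 + x\<^sup>2)))"
    by (simp add: set_integrable_def divide_inverse)
  from lborel_integrable_real_affine[OF this, of "-1" 0]
  have "integrable lborel (\<lambda>x::real. indicator {0<..} x * (1 / (1 + x\<^sup>2))
      + indicator {0<..} (-x) * (1 / (1 + x\<^sup>2)))"
    using i by (intro Bochner_Integration.integrable_add) auto
  then show ?thesis
    by (rule integrable_cong_AE_imp)
      (use AE_lborel_singleton[of 0] in \<open>auto elim!: eventually_mono simp: indicator_def\<close>)
qed

subsection \<open>Derivatives of the squared Cramer distance\<close>

text \<open>\<open>R\<close> stands for all that stays fixed while one parameter \<open>t\<close> of
  one component moves. Factoring the difference of two squares, the sum of the two bases is at most
  2 in absolute value, which yields the dominating function \<open>2 * p * K\<close>.\<close>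

lemma DERIV_integral_square_affine:
  fixes G G' :: "real \<Rightarrow> real \<Rightarrow> real"
  assumes "\<delta> > 0" "p \<ge> 0"
    and meas: "\<And>t. t \<in> ball a \<delta> \<Longrightarrow> G t \<in> borel_measurable lborel"
    and meas': "G' a \<in> borel_measurable lborel"
    and R: "R \<in> borel_measurable lborel"
    and der: "\<And>t x. t \<in> ball a \<delta> \<Longrightarrow> ((\<lambda>t. G t x) has_real_derivative G' t x) (at t)"
    and bound: "\<And>t x. t \<in> ball a \<delta> \<Longrightarrow> \<bar>p * G t x + R x\<bar> \<le> 1"
    and G'K: "\<And>t x. t \<in> ball a \<delta> \<Longrightarrow> \<bar>G' t x\<bar> \<le> K x"
    and K: "integrable lborel K"
    and int: "integrable lborel (\<lambda>x. (p * G a x + R x)\<^sup>2)"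
  shows "\<exists>D. ((\<lambda>t. LINT x|lborel. (p * G t x + R x)\<^sup>2) has_real_derivative D) (at a)
    \<and> \<bar>D\<bar> \<le> 2 * p * (LINT x|lborel. \<bar>G' a x\<bar>)"
proof -
  let ?f = "\<lambda>t x. (p * G t x + R x)\<^sup>2"
  let ?g = "\<lambda>x. 2 * (p * G a x + R x) * (p * G' a x)"
  have a: "a \<in> ball a \<delta>" using \<open>\<delta> > 0\<close> by simp
  note [measurable] = meas[OF a] meas' R
  have der_f: "((\<lambda>t. ?f t x) has_derivative (\<lambda>h. ?g x \<bullet> h)) (at a)" for x
  proof -
    have "((\<lambda>t. ?f t x) has_real_derivative ?g x) (at a)"
      by (auto intro!: derivative_eq_intros der[OF a])
    then show ?thesis by (simp add: has_field_derivative_def)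
  qed
  have lip_G: "\<bar>G t x - G a x\<bar> \<le> K x * \<bar>t - a\<bar>" if "t \<in> ball a \<delta>" for t x
    using field_differentiable_bound[of "ball a \<delta>" "\<lambda>t. G t x" "\<lambda>t. G' t x" "K x" t a]
      der G'K that a by (auto intro: DERIV_subset)
  have lip: "\<bar>?f t x - ?f a x\<bar> \<le> 2 * p * K x * norm (t - a)" if t: "t \<in> ball a \<delta>" for t x
  proof -
    have "?f t x - ?f a x = p * (G t x - G a x) * ((p * G t x + R x) + (p * G a x + R x))"
      by (simp add: power2_eq_square algebra_simps)
    also have "\<bar>\<dots>\<bar> \<le> p * (K x * \<bar>t - a\<bar>) * 2"
      unfolding abs_mult
    proof (intro mult_mono)
      show "\<bar>(p * G t x + R x) + (p * G a x + R x)\<bar> \<le> 2"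
        using bound[OF t, of x] bound[OF a, of x] by linarith
    qed (use \<open>p \<ge> 0\<close> lip_G[OF t, of x] in auto)
    finally show ?thesis by (simp add: mult_ac)
  qed
  have mf: "?f t \<in> borel_measurable lborel" if "t \<in> ball a \<delta>" for t
    using meas[OF that] R by measurable
  have mg: "?g \<in> borel_measurable lborel" by measurable
  have iK: "integrable lborel (\<lambda>x. 2 * p * K x)" using K by simp
  note * = has_derivative_integral_dominated[where f = ?f and g = ?g and K = "\<lambda>x. 2 * p * K x",
      OF \<open>\<delta> > 0\<close> mf int mg AE_I2[OF der_f] AE_I2[OF ballI[OF lip]] iK]
  have iG': "integrable lborel (G' a)"
    by (rule Bochner_Integration.integrable_bound[OF K]) (auto intro!: AE_I2 order_trans[OF G'K[OF a] abs_ge_self])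
  \<comment> \<open>The final constant comes from integrating the gradient itself. Bounding by
    \<open>K\<close> would leave a constant that depends on the choice of dominating
    function.\<close>
  have "\<bar>LINT x|lborel. ?g x\<bar> \<le> (LINT x|lborel. \<bar>?g x\<bar>)"
    by (rule integral_abs_bound)
  also have "\<dots> \<le> (LINT x|lborel. 2 * p * \<bar>G' a x\<bar>)"
  proof (rule integral_mono)
    show "integrable lborel (\<lambda>x. \<bar>?g x\<bar>)" by (rule integrable_abs[OF *(1)])
    show "integrable lborel (\<lambda>x. 2 * p * \<bar>G' a x\<bar>)" using iG' by simp
    show "\<bar>?g x\<bar> \<le> 2 * p * \<bar>G' a x\<bar>" for x
    proof -
      have "\<bar>?g x\<bar> = \<bar>p * G a x + R x\<bar> * (2 * p * \<bar>G' a x\<bar>)"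
        using \<open>p \<ge> 0\<close> by (simp add: abs_mult del: distrib_left_numeral)
      also have "\<dots> \<le> 1 * (2 * p * \<bar>G' a x\<bar>)"
        using bound[OF a, of x] \<open>p \<ge> 0\<close> by (intro mult_right_mono) auto
      finally show ?thesis by simp
    qed
  qed
  finally have "\<bar>LINT x|lborel. ?g x\<bar> \<le> 2 * p * (LINT x|lborel. \<bar>G' a x\<bar>)" by simp
  moreover have "((\<lambda>t. LINT x|lborel. ?f t x) has_real_derivative (LINT x|lborel. ?g x)) (at a)"
    using *(3) by (simp add: has_field_derivative_def)
  ultimately show ?thesis by blast
qed

lemma DERIV_gauss_cdf_mean:
  assumes "s > 0"
  shows "((\<lambda>u. gauss_cdf u (s\<^sup>2) x) has_real_derivative - normal_density u s x) (at u)"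
proof -
  have "((\<lambda>u. gauss_cdf 0 1 ((x - u) / s)) has_real_derivative
      std_normal_density ((x - u) / s) * (- 1 / s)) (at u)"
    by (rule DERIV_chain2[OF DERIV_std_gauss_cdf]) (use assms in \<open>auto intro!: derivative_eq_intros\<close>)
  moreover have "std_normal_density ((x - u) / s) = s * normal_density u s x"
    using normal_density_affine_std[OF assms, of u "(x - u) / s"] assms by simp
  ultimately show ?thesis using assms by (simp add: gauss_cdf_standardize)
qed

lemma DERIV_gauss_cdf_sd:
  assumes "s > 0"
  shows "((\<lambda>s. gauss_cdf u (s\<^sup>2) x) has_real_derivative - ((x - u) / s * normal_density u s x)) (at s)"
proof -
  have "((\<lambda>s. gauss_cdf 0 1 ((x - u) / s)) has_real_derivative
      std_normal_density ((x - u) / s) * (- (x - u) / s\<^sup>2)) (at s)"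
    by (rule DERIV_chain2[OF DERIV_std_gauss_cdf])
      (use assms in \<open>auto intro!: derivative_eq_intros simp: power2_eq_square divide_simps\<close>)
  moreover have "std_normal_density ((x - u) / s) = s * normal_density u s x"
    using normal_density_affine_std[OF assms, of u "(x - u) / s"] assms by simp
  moreover have "s * normal_density u s x * (- (x - u) / s\<^sup>2) = - ((x - u) / s * normal_density u s x)"
    using assms by (simp add: power2_eq_square field_simps)
  ultimately have "((\<lambda>s. gauss_cdf 0 1 ((x - u) / s)) has_real_derivative
      - ((x - u) / s * normal_density u s x)) (at s)"
    by (simp only:)
  \<comment> \<open>Standardization is valid only for a positive standard deviation, so the two
    functions are compared within distance \<open>s\<close> of \<open>s\<close>.\<close>
  then show ?thesis
    by (rule has_field_derivative_transform_within[where d = s])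
      (use assms in \<open>auto simp: gauss_cdf_standardize dist_real_def\<close>)
qed

text \<open>From \<open>(x - u)\<^sup>2 \<le> 2 * (x - t)\<^sup>2 + 2\<close> one wider Gaussian
  dominates all densities with mean within 1 of \<open>u\<close>. The exponential absorbs the
  additive 2, and \<open>sqrt 2\<close> corrects the normalization.\<close>

lemma normal_density_le_shifted_mean:
  assumes "s > 0" "\<bar>t - u\<bar> \<le> 1"
  shows "normal_density t s x \<le> sqrt 2 * exp (1 / (2 * s\<^sup>2)) * normal_density u (sqrt 2 * s) x"
proof -
  have sq: "(t - u)\<^sup>2 \<le> 1" using power_mono[OF assms(2), of 2] by simp
  have "(x - u)\<^sup>2 \<le> 2 * (x - t)\<^sup>2 + 2 * (t - u)\<^sup>2"
    using sum_squares_ge_zero[of "x - t - (t - u)" 0] by (simp add: power2_eq_square algebra_simps)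
  with sq have "(x - u)\<^sup>2 \<le> 2 * (x - t)\<^sup>2 + 2" by linarith
  then have "- (x - t)\<^sup>2 / (2 * s\<^sup>2) \<le> 1 / (2 * s\<^sup>2) + - (x - u)\<^sup>2 / (2 * (sqrt 2 * s)\<^sup>2)"
    using assms(1) by (simp add: power_mult_distrib divide_simps)
  then have e: "exp (- (x - t)\<^sup>2 / (2 * s\<^sup>2))
      \<le> exp (1 / (2 * s\<^sup>2)) * exp (- (x - u)\<^sup>2 / (2 * (sqrt 2 * s)\<^sup>2))"
    by (simp flip: exp_add)
  have c: "sqrt 2 / sqrt (2 * pi * (sqrt 2 * s)\<^sup>2) = 1 / sqrt (2 * pi * s\<^sup>2)"
    using assms by (simp add: power_mult_distrib real_sqrt_mult) (simp add: field_simps)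
  have "sqrt 2 * exp (1 / (2 * s\<^sup>2)) * normal_density u (sqrt 2 * s) x
      = sqrt 2 / sqrt (2 * pi * (sqrt 2 * s)\<^sup>2)
        * (exp (1 / (2 * s\<^sup>2)) * exp (- (x - u)\<^sup>2 / (2 * (sqrt 2 * s)\<^sup>2)))"
    unfolding normal_density_def by (simp only: mult_ac times_divide_eq_left times_divide_eq_right mult_1_left mult_1_right)
  also have "\<dots> = 1 / sqrt (2 * pi * s\<^sup>2) * (exp (1 / (2 * s\<^sup>2)) * exp (- (x - u)\<^sup>2 / (2 * (sqrt 2 * s)\<^sup>2)))"
    by (simp only: c)
  finally show ?thesis
    using mult_left_mono[OF e, of "1 / sqrt (2 * pi * s\<^sup>2)"]
    by (simp add: normal_density_def)
qed

text \<open>Passing to the larger standard deviation only increases the exponential, while the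
  normalizing factor shrinks by at most the ratio \<open>c\<close>.\<close>

lemma normal_density_le_scaled_sd:
  assumes "0 < t'" "t' \<le> t" "t \<le> c * t'"
  shows "normal_density u t' x \<le> c * normal_density u t x"
proof -
  have "0 < c * t'" using assms by linarith
  then have t': "0 < t" "0 < c" using assms by (simp_all add: zero_less_mult_iff)
  have sq: "sqrt (2 * pi * r\<^sup>2) = sqrt (2 * pi) * r" if "r > 0" for r
    using that by (simp add: real_sqrt_mult)
  have "exp (- (x - u)\<^sup>2 / (2 * t'\<^sup>2)) \<le> exp (- (x - u)\<^sup>2 / (2 * t\<^sup>2))"
    using assms t' by (auto intro!: divide_left_mono power_mono mult_pos_pos)
  moreover have "1 / (sqrt (2 * pi) * t') \<le> c / (sqrt (2 * pi) * t)"
    using assms t' by (simp add: divide_simps)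
  ultimately have "1 / (sqrt (2 * pi) * t') * exp (- (x - u)\<^sup>2 / (2 * t'\<^sup>2))
      \<le> c / (sqrt (2 * pi) * t) * exp (- (x - u)\<^sup>2 / (2 * t\<^sup>2))"
    using t' assms by (intro mult_mono) auto
  then show ?thesis using assms t' by (simp add: normal_density_def sq)
qed

lemma DERIV_integral_square_gauss_mean:
  assumes "p \<ge> 0" "s > 0"
    and R: "R \<in> borel_measurable lborel"
    and bound: "\<And>u x. \<bar>p * gauss_cdf u (s\<^sup>2) x + R x\<bar> \<le> 1"
    and int: "integrable lborel (\<lambda>x. (p * gauss_cdf u (s\<^sup>2) x + R x)\<^sup>2)"
  shows "\<exists>D. ((\<lambda>u. LINT x|lborel. (p * gauss_cdf u (s\<^sup>2) x + R x)\<^sup>2) has_real_derivative D) (at u)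
    \<and> \<bar>D\<bar> \<le> 2 * p"
proof -
  have "\<exists>D. ((\<lambda>u. LINT x|lborel. (p * gauss_cdf u (s\<^sup>2) x + R x)\<^sup>2) has_real_derivative D) (at u)
    \<and> \<bar>D\<bar> \<le> 2 * p * (LINT x|lborel. \<bar>- normal_density u s x\<bar>)"
  proof (rule DERIV_integral_square_affine[where \<delta> = 1 and G' = "\<lambda>u x. - normal_density u s x"
      and K = "\<lambda>x. sqrt 2 * exp (1 / (2 * s\<^sup>2)) * normal_density u (sqrt 2 * s) x"])
    show "integrable lborel (\<lambda>x. sqrt 2 * exp (1 / (2 * s\<^sup>2)) * normal_density u (sqrt 2 * s) x)"
      using assms by simp
    show "\<bar>- normal_density t s x\<bar> \<le> sqrt 2 * exp (1 / (2 * s\<^sup>2)) * normal_density u (sqrt 2 * s) x"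
      if "t \<in> ball u 1" for t x
      using normal_density_le_shifted_mean[OF \<open>s > 0\<close>, of t u x] that by (simp add: dist_real_def abs_minus_commute)
  qed (use assms in \<open>auto intro: DERIV_gauss_cdf_mean\<close>)
  then show ?thesis using \<open>s > 0\<close> by simp
qed

lemma DERIV_integral_square_gauss_sd:
  assumes "p \<ge> 0" "s > 0"
    and R: "R \<in> borel_measurable lborel"
    and bound: "\<And>s x. s > 0 \<Longrightarrow> \<bar>p * gauss_cdf u (s\<^sup>2) x + R x\<bar> \<le> 1"
    and int: "integrable lborel (\<lambda>x. (p * gauss_cdf u (s\<^sup>2) x + R x)\<^sup>2)"
  shows "\<exists>D. ((\<lambda>s. LINT x|lborel. (p * gauss_cdf u (s\<^sup>2) x + R x)\<^sup>2) has_real_derivative D) (at s)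
    \<and> \<bar>D\<bar> \<le> 2 * p"
proof -
  have "\<exists>D. ((\<lambda>s. LINT x|lborel. (p * gauss_cdf u (s\<^sup>2) x + R x)\<^sup>2) has_real_derivative D) (at s)
    \<and> \<bar>D\<bar> \<le> 2 * p * (LINT x|lborel. \<bar>- ((x - u) / s * normal_density u s x)\<bar>)"
  \<comment> \<open>Radius \<open>s / 2\<close> keeps \<open>t\<close> between \<open>s / 2\<close>
    and \<open>3 * s / 2\<close>. Then \<open>1 / t \<le> 2 / s\<close>, and the density at
    \<open>t\<close> is at most 3 times the one at \<open>3 * s / 2\<close>; together these give
    \<open>6 / s\<close>.\<close>
  proof (rule DERIV_integral_square_affine[where \<delta> = "s / 2"
      and G' = "\<lambda>s x. - ((x - u) / s * normal_density u s x)"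
      and K = "\<lambda>x. 6 / s * (normal_density u (3 * s / 2) x * \<bar>x - u\<bar>)"])
    show "integrable lborel (\<lambda>x. 6 / s * (normal_density u (3 * s / 2) x * \<bar>x - u\<bar>))"
      using integrable_normal_moment_abs[of "3 * s / 2" u 1] assms by simp
    show "\<bar>- ((x - u) / t * normal_density u t x)\<bar> \<le> 6 / s * (normal_density u (3 * s / 2) x * \<bar>x - u\<bar>)"
      if "t \<in> ball s (s / 2)" for t x
    proof -
      have t: "s / 2 < t" "t < 3 * s / 2" using that by (auto simp: dist_real_def abs_real_def split: if_splits)
      then have "normal_density u t x \<le> 3 * normal_density u (3 * s / 2) x"
        using \<open>s > 0\<close> by (intro normal_density_le_scaled_sd) auto
      moreover have "\<bar>x - u\<bar> / t \<le> \<bar>x - u\<bar> * (2 / s)"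
        using t \<open>s > 0\<close> mult_left_mono[of s "2 * t" "\<bar>x - u\<bar>"] by (simp add: divide_simps mult_ac)
      ultimately have "\<bar>x - u\<bar> / t * normal_density u t x \<le> \<bar>x - u\<bar> * (2 / s) * (3 * normal_density u (3 * s / 2) x)"
        using t \<open>s > 0\<close> by (intro mult_mono) auto
      then show ?thesis using t \<open>s > 0\<close> by (simp add: abs_mult mult_ac)
    qed
    show "t \<in> ball s (s / 2) \<Longrightarrow> \<bar>p * gauss_cdf u (t\<^sup>2) x + R x\<bar> \<le> 1" for t x
      using \<open>s > 0\<close> by (intro bound) (auto simp: dist_real_def abs_real_def split: if_splits)
    show "((\<lambda>s. gauss_cdf u (s\<^sup>2) x) has_real_derivative - ((x - u) / t * normal_density u t x)) (at t)"
      if "t \<in> ball s (s / 2)" for t x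
      using that \<open>s > 0\<close>
      by (intro DERIV_gauss_cdf_sd) (auto simp: dist_real_def abs_real_def split: if_splits)
  qed (use assms in auto)
  \<comment> \<open>This is the first absolute moment of a standard normal variable,
    \<open>sqrt (2 / pi)\<close>.\<close>
  moreover have "(LINT x|lborel. \<bar>- ((x - u) / s * normal_density u s x)\<bar>) \<le> 1"
  proof -
    have "(LINT x|lborel. \<bar>- ((x - u) / s * normal_density u s x)\<bar>)
        = (LINT x|lborel. (1 / s) * (normal_density u s x * \<bar>x - u\<bar>))"
      using \<open>s > 0\<close> by (intro Bochner_Integration.integral_cong) (auto simp: abs_mult mult_ac)
    also have "\<dots> = sqrt (2 / pi)"
      using integral_normal_moment_abs_odd[OF \<open>s > 0\<close>, of u 0] \<open>s > 0\<close>
      by (subst integral_mult_right_zero) simp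
    also have "\<dots> \<le> 1" using pi_gt3 by simp
    finally show ?thesis .
  qed
  ultimately show ?thesis
    using \<open>p \<ge> 0\<close> by (meson mult_left_le mult_nonneg_nonneg order_trans zero_le_numeral)
qed

subsection \<open>Mixtures and the sphere integral\<close>

text \<open>Means and variances are free sequences here rather than functions of a direction, so a
  single one can be changed by a function update.\<close>

definition mixture_cdf ::
  "(nat \<Rightarrow> real) \<Rightarrow> (nat \<Rightarrow> real) \<Rightarrow> (nat \<Rightarrow> real) \<Rightarrow> nat \<Rightarrow> real \<Rightarrow> real" where
  "mixture_cdf p u v n x = (\<Sum>i<n. p i * gauss_cdf (u i) (v i) x)"

lemma proj_mixture_cdf_eq_mixture_cdf:
  "proj_mixture_cdf p mu Sg n nu =
    mixture_cdf p (\<lambda>i. mu i \<bullet> nu) (\<lambda>i. nu \<bullet> (Sg i *v nu)) n"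
  by (rule ext) (simp add: proj_mixture_cdf_def mixture_cdf_def)

lemma mixture_cdf_measurable [measurable]: "mixture_cdf p u v n \<in> borel_measurable borel"
  unfolding mixture_cdf_def by measurable

lemma mixture_cdf_bounds:
  assumes "\<forall>i<n. p i \<ge> 0" "(\<Sum>i<n. p i) = 1" "\<forall>i<n. v i > 0"
  shows "0 \<le> mixture_cdf p u v n x" "mixture_cdf p u v n x \<le> 1"
proof -
  show "0 \<le> mixture_cdf p u v n x"
    unfolding mixture_cdf_def using assms by (intro sum_nonneg mult_nonneg_nonneg gauss_cdf_nonneg) auto
  have "mixture_cdf p u v n x \<le> (\<Sum>i<n. p i * 1)"
    unfolding mixture_cdf_def using assms by (intro sum_mono mult_left_mono gauss_cdf_le_1) auto
  then show "mixture_cdf p u v n x \<le> 1" using assms by simp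
qed

text \<open>Because the weights sum to 1, the step function can be moved inside the sum and each
  component estimated separately. The same step function serves as reference for both
  mixtures.\<close>

lemma mixture_cdf_tail_bound:
  assumes "\<forall>i<n. p i \<ge> 0" "(\<Sum>i<n. p i) = 1" "\<forall>i<n. v i > 0"
  shows "\<bar>mixture_cdf p u v n x - indicator {0..} x\<bar> \<le> (\<Sum>i<n. p i * (1 + (u i)\<^sup>2 + v i)) * (1 / (1 + x\<^sup>2))"
proof -
  have "mixture_cdf p u v n x - indicator {0..} x
      = (\<Sum>i<n. p i * (gauss_cdf (u i) (v i) x - indicator {0..} x))"
    using assms(2) by (simp add: mixture_cdf_def right_diff_distrib sum_subtractf flip: sum_distrib_right)
  also have "\<bar>\<dots>\<bar> \<le> (\<Sum>i<n. \<bar>p i * (gauss_cdf (u i) (v i) x - indicator {0..} x)\<bar>)"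
    by (rule sum_abs)
  also have "\<dots> \<le> (\<Sum>i<n. p i * ((1 + (u i)\<^sup>2 + v i) / (1 + x\<^sup>2)))"
    using assms(1,3) by (intro sum_mono)
      (auto simp: abs_mult simp del: times_divide_eq_right intro!: mult_left_mono gauss_cdf_tail_bound)
  finally show ?thesis by (simp add: sum_divide_distrib)
qed

context
  fixes p p' u' v' :: "nat \<Rightarrow> real" and n n' :: nat
  assumes p: "\<forall>i<n. p i \<ge> 0" "(\<Sum>i<n. p i) = 1"
    and p': "\<forall>k<n'. p' k \<ge> 0" "(\<Sum>k<n'. p' k) = 1"
    and v': "\<forall>k<n'. v' k > 0"
begin

lemma mixture_cdf_diff_le_1:
  assumes "\<forall>i<n. v i > 0"
  shows "\<bar>mixture_cdf p u v n x - mixture_cdf p' u' v' n' x\<bar> \<le> 1"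
  using mixture_cdf_bounds[OF p assms, of u x] mixture_cdf_bounds[OF p' v', of u' x] by linarith

text \<open>The difference is at most 1 in absolute value, so its square is at most that absolute
  value, which the two tail bounds control by the triangle inequality. The explicit constant later
  permits a bound uniform in the direction.\<close>

lemma C2sq_mixture_cdf:
  assumes v: "\<forall>i<n. v i > 0"
  shows "integrable lborel (\<lambda>x. (mixture_cdf p u v n x - mixture_cdf p' u' v' n' x)\<^sup>2)"
    and "C2sq (mixture_cdf p u v n) (mixture_cdf p' u' v' n')
      \<le> ((\<Sum>i<n. p i * (1 + (u i)\<^sup>2 + v i)) + (\<Sum>k<n'. p' k * (1 + (u' k)\<^sup>2 + v' k)))
        * (LINT x|lborel. 1 / (1 + x\<^sup>2))"
proof -
  let ?d = "\<lambda>x. mixture_cdf p u v n x - mixture_cdf p' u' v' n' x"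
  let ?C = "(\<Sum>i<n. p i * (1 + (u i)\<^sup>2 + v i)) + (\<Sum>k<n'. p' k * (1 + (u' k)\<^sup>2 + v' k))"
  have bd: "(?d x)\<^sup>2 \<le> ?C * (1 / (1 + x\<^sup>2))" for x
  proof -
    have "(?d x)\<^sup>2 = \<bar>?d x\<bar> * \<bar>?d x\<bar>" by (simp add: power2_eq_square)
    also have "\<dots> \<le> \<bar>?d x\<bar> * 1"
      by (intro mult_left_mono mixture_cdf_diff_le_1 v) auto
    also have "\<dots> = \<bar>?d x\<bar>" by simp
    also have "\<dots> \<le> ?C * (1 / (1 + x\<^sup>2))"
      using mixture_cdf_tail_bound[OF p v, of u x] mixture_cdf_tail_bound[OF p' v', of u' x]
      unfolding distrib_right by (simp only: abs_le_iff) linarith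
    finally show ?thesis .
  qed
  have i: "integrable lborel (\<lambda>x::real. ?C * (1 / (1 + x\<^sup>2)))"
    by (intro integrable_mult_right integrable_inverse_1_plus_square)
  show int: "integrable lborel (\<lambda>x. (?d x)\<^sup>2)"
    by (rule Bochner_Integration.integrable_bound[OF i]) (auto intro!: AE_I2 order_trans[OF bd] divide_right_mono)
  have "(LINT x|lborel. (?d x)\<^sup>2) \<le> (LINT x|lborel. ?C * (1 / (1 + x\<^sup>2)))"
    by (rule integral_mono[OF int i bd])
  then show "C2sq (mixture_cdf p u v n) (mixture_cdf p' u' v' n') \<le> ?C * (LINT x|lborel. 1 / (1 + x\<^sup>2))"
    unfolding C2sq_def integral_mult_right_zero .
qed

text \<open>One remainder \<open>R\<close> serves all \<open>t\<close> and \<open>r\<close>; it can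
  therefore be held fixed while differentiating in either parameter.\<close>

lemma mixture_cdf_update_split:
  assumes "j < n"
  shows "\<exists>R\<in>borel_measurable lborel. \<forall>t r x.
    mixture_cdf p (u(j := t)) (v(j := r)) n x - mixture_cdf p' u' v' n' x = p j * gauss_cdf t r x + R x"
proof (intro bexI allI)
  let ?R = "\<lambda>x. (\<Sum>i\<in>{..<n}-{j}. p i * gauss_cdf (u i) (v i) x) - mixture_cdf p' u' v' n' x"
  show "?R \<in> borel_measurable lborel" by measurable
  show "mixture_cdf p (u(j := t)) (v(j := r)) n x - mixture_cdf p' u' v' n' x
      = p j * gauss_cdf t r x + ?R x" for t r x
    using assms unfolding mixture_cdf_def by (simp add: sum.remove[of "{..<n}" j])
qed

lemma DERIV_C2sq_mixture_mean:
  assumes j: "j < n" and v: "\<forall>i<n. v i > 0"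
  shows "\<exists>D. ((\<lambda>t. C2sq (mixture_cdf p (u(j := t)) v n) (mixture_cdf p' u' v' n')) has_real_derivative D) (at t)
    \<and> \<bar>D\<bar> \<le> 2 * p j"
proof -
  obtain R where R: "R \<in> borel_measurable lborel"
    and eq: "\<And>t r x. mixture_cdf p (u(j := t)) (v(j := r)) n x - mixture_cdf p' u' v' n' x
      = p j * gauss_cdf t r x + R x"
    using mixture_cdf_update_split[OF j, of u v] by blast
  let ?s = "sqrt (v j)"
  have s: "?s > 0" "?s\<^sup>2 = v j" using v j by (auto simp: less_imp_le)
  have eq': "mixture_cdf p (u(j := t)) v n x - mixture_cdf p' u' v' n' x
      = p j * gauss_cdf t (?s\<^sup>2) x + R x" for t x
    using eq[of t "v j" x] s by simp
  show ?thesis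
    unfolding C2sq_def eq'
    using mixture_cdf_diff_le_1[OF v, of "u(j := _)", unfolded eq']
      C2sq_mixture_cdf(1)[OF v, of "u(j := _)", unfolded eq'] R s(1) p j
    by (intro DERIV_integral_square_gauss_mean) auto
qed

text \<open>The variable is the standard deviation, not the variance: for covariance
  \<open>transpose A ** A\<close> it equals \<open>norm (A *v nu)\<close>, which is Lipschitz in
  \<open>A\<close>.\<close>

lemma DERIV_C2sq_mixture_sd:
  assumes j: "j < n" and v: "\<forall>i<n. v i > 0" and s: "s > 0"
  shows "\<exists>D. ((\<lambda>s. C2sq (mixture_cdf p u (v(j := s\<^sup>2)) n) (mixture_cdf p' u' v' n')) has_real_derivative D) (at s)
    \<and> \<bar>D\<bar> \<le> 2 * p j"
proof -
  obtain R where R: "R \<in> borel_measurable lborel"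
    and eq: "\<And>t r x. mixture_cdf p (u(j := t)) (v(j := r)) n x - mixture_cdf p' u' v' n' x
      = p j * gauss_cdf t r x + R x"
    using mixture_cdf_update_split[OF j, of u v] by blast
  have eq': "mixture_cdf p u (v(j := r)) n x - mixture_cdf p' u' v' n' x
      = p j * gauss_cdf (u j) r x + R x" for r x
    using eq[of "u j" r x] by simp
  have v2: "\<forall>i<n. (v(j := r\<^sup>2)) i > 0" if "r > 0" for r
    using v that by simp
  show ?thesis
    unfolding C2sq_def eq'
    using mixture_cdf_diff_le_1[OF v2, of _ u, unfolded eq']
      C2sq_mixture_cdf(1)[OF v2, of _ u, unfolded eq'] R s p j
    by (intro DERIV_integral_square_gauss_sd) auto
qed

end

section \<open>Differentiation under the sphere integral in polar form\<close>

lemma sphere_area_eq_ball_volume: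
  "real CARD('m) * measure lborel (ball (0::real^'m) 1) = sphere_area CARD('m)"
proof -
  let ?m = "real CARD('m)"
  have m: "?m / 2 > 0" by simp
  \<comment> \<open>This recurrence cancels the dimension factor of the cone construction and leaves
    the 2 in \<open>sphere_area\<close>.\<close>
  have "Gamma (?m / 2 + 1) = ?m / 2 * Gamma (?m / 2)"
    using m by (intro Gamma_plus1) (auto dest: nonpos_Ints_nonpos)
  moreover have "real CARD('m) * measure lborel (ball (0::real^'m) 1)
      = ?m * (pi powr (?m / 2) / Gamma (?m / 2 + 1))"
    by (simp add: content_ball unit_ball_vol_def)
  ultimately show ?thesis
    unfolding sphere_area_def by (simp only:) simp
qed

text \<open>The integrand is extended radially to the unit ball, where
  \<open>w /\<^sub>R norm w\<close> is a unit vector except at the null point 0. The constant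
  \<open>c\<close> on the ball dominates, and the ball volume times the dimension is the sphere
  area.\<close>

lemma differentiable_sphere_integral:
  fixes F :: "'a::euclidean_space \<Rightarrow> real^'m \<Rightarrow> real"
  assumes "\<delta> > 0"
    and meas: "\<And>y. y \<in> ball a \<delta> \<Longrightarrow> (\<lambda>w. F y (w /\<^sub>R norm w)) \<in> borel_measurable borel"
    and bound: "\<And>nu. norm nu = 1 \<Longrightarrow> \<bar>F a nu\<bar> \<le> B"
    and lip: "\<And>y nu. y \<in> ball a \<delta> \<Longrightarrow> norm nu = 1 \<Longrightarrow> \<bar>F y nu - F a nu\<bar> \<le> c * norm (y - a)"
    and diff: "\<And>nu. norm nu = 1 \<Longrightarrow> (\<lambda>y. F y nu) differentiable (at a)"
  shows "\<exists>g. ((\<lambda>y. sphere_integral (F y)) has_derivative (\<lambda>h. g \<bullet> h)) (at a)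
    \<and> norm g \<le> c * sphere_area CARD('m)"
proof -
  let ?f = "\<lambda>y w. indicator (ball 0 1) w * F y (w /\<^sub>R norm w)"
  let ?K = "\<lambda>w::real^'m. c * indicator (ball 0 1) w"
  have fin: "emeasure lborel (ball (0::real^'m) 1) < \<infinity>"
    by (rule emeasure_bounded_finite) simp
  have unit: "norm (w /\<^sub>R norm w) = 1" if "w \<noteq> 0" for w :: "real^'m" using that by simp
  have AE0: "AE w in lborel. w \<noteq> (0::real^'m)" by (rule AE_lborel_singleton)
  have "\<exists>g. ((\<lambda>y. LINT w|lborel. ?f y w) has_derivative (\<lambda>h. g \<bullet> h)) (at a)
    \<and> norm g \<le> (LINT w|lborel. ?K w)"
  proof (rule differentiable_integral_dominated[OF \<open>\<delta> > 0\<close>])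
    show mf: "?f y \<in> borel_measurable lborel" if "y \<in> ball a \<delta>" for y
      by (intro borel_measurable_times borel_measurable_indicator) (use meas[OF that] in simp_all)
    show "integrable lborel (?f a)"
    proof (rule Bochner_Integration.integrable_bound)
      show "integrable lborel (\<lambda>w::real^'m. B * indicator (ball 0 1) w)" using fin by simp
      show "?f a \<in> borel_measurable lborel" using mf \<open>\<delta> > 0\<close> by simp
      show "AE w in lborel. norm (?f a w) \<le> norm (B * indicator (ball 0 1) w)"
        using AE0
        by eventually_elim
          (use bound[OF unit] in \<open>auto simp: indicator_def intro: order_trans[OF _ abs_ge_self]\<close>)
    qed
    show "AE w in lborel. (\<lambda>y. ?f y w) differentiable (at a)"
      using AE0 by eventually_elim (auto intro!: differentiable_mult diff unit)
    show "AE w in lborel. \<forall>y\<in>ball a \<delta>. \<bar>?f y w - ?f a w\<bar> \<le> ?K w * norm (y - a)"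
      using AE0 by eventually_elim (use lip[OF _ unit] in \<open>auto simp: indicator_def\<close>)
    show "integrable lborel ?K" using fin by simp
  qed
  then obtain g where g: "((\<lambda>y. LINT w|lborel. ?f y w) has_derivative (\<lambda>h. g \<bullet> h)) (at a)"
    and le: "norm g \<le> c * measure lborel (ball (0::real^'m) 1)" by auto
  have "((\<lambda>y. sphere_integral (F y)) has_derivative (\<lambda>h. (real CARD('m) *\<^sub>R g) \<bullet> h)) (at a)"
    unfolding sphere_integral_def set_lebesgue_integral_def
    using has_derivative_mult_right[OF g, of "real CARD('m)"] by simp
  moreover have "norm (real CARD('m) *\<^sub>R g) \<le> c * sphere_area CARD('m)"
    using mult_left_mono[OF le, of "real CARD('m)"]
    unfolding sphere_area_eq_ball_volume[symmetric] by (simp add: mult_ac)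
  ultimately show ?thesis by blast
qed

section \<open>Matrix norms, measurability in the direction, and bounds uniform in it\<close>

lemma norm_matrix_vector_mult_le:
  fixes A :: "real^'n^'m"
  shows "norm (A *v x) \<le> norm A * norm x"
proof -
  \<comment> \<open>Cauchy-Schwarz row by row. The \<open>norm\<close> of a matrix, as a vector of
    rows, is its Frobenius norm, so the gradient bound for matrices is a Frobenius bound
    too.\<close>
  have "norm (A *v x) \<le> L2_set (\<lambda>i. norm (A $ i) * norm x) UNIV"
    unfolding norm_vec_def[of "A *v x"]
    by (intro L2_set_mono) (auto simp: matrix_vector_mul_component Cauchy_Schwarz_ineq2)
  also have "\<dots> = norm A * norm x"
    by (simp add: norm_vec_def[of A] L2_set_left_distrib)
  finally show ?thesis .
qed

lemma inner_gram_matrix_vector: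
  fixes A :: "real^'n^'n"
  shows "x \<bullet> ((transpose A ** A) *v x) = (norm (A *v x))\<^sup>2"
  by (simp add: power2_norm_eq_inner matrix_vector_mul_assoc[symmetric] dot_lmul_matrix[symmetric]
      inner_commute)

lemma matrix_vector_mult_measurable [measurable (raw)]:
  fixes A :: "real^'n^'m"
  assumes "f \<in> borel_measurable M"
  shows "(\<lambda>w. A *v f w) \<in> borel_measurable M"
proof -
  have "(\<lambda>x. A *v x) \<in> borel_measurable borel"
    by (intro borel_measurable_continuous_onI linear_continuous_on
        linear_conv_bounded_linear[THEN iffD1]) (rule matrix_vector_mul_linear)
  with assms show ?thesis by (rule measurable_compose)
qed

text \<open>\<open>C2sq\<close> is a parameter integral of a jointly measurable integrand. At
  \<open>w = 0\<close> the direction becomes 0 and the projected variances degenerate to 0;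
  measurability covers this point as well.\<close>

lemma C2sq_proj_mixture_cdf_measurable:
  "(\<lambda>w::real^'m. C2sq (proj_mixture_cdf p mu Sg n (w /\<^sub>R norm w))
      (proj_mixture_cdf p' mu' Sg' n' (w /\<^sub>R norm w))) \<in> borel_measurable borel"
  unfolding C2sq_def proj_mixture_cdf_def by measurable

lemma DERIV_bounded_imp_Lipschitz:
  fixes f :: "real \<Rightarrow> real"
  assumes "convex X"
    and der: "\<And>t. t \<in> X \<Longrightarrow> \<exists>D. (f has_real_derivative D) (at t) \<and> \<bar>D\<bar> \<le> c"
    and "s \<in> X" "t \<in> X"
  shows "\<bar>f s - f t\<bar> \<le> c * \<bar>s - t\<bar>"
proof -
  from der obtain D where D: "\<And>t. t \<in> X \<Longrightarrow> (f has_real_derivative D t) (at t)"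
    "\<And>t. t \<in> X \<Longrightarrow> \<bar>D t\<bar> \<le> c" by metis
  have "norm (f s - f t) \<le> c * norm (s - t)"
    by (rule field_differentiable_bound[OF \<open>convex X\<close>, of f D c])
      (use D assms(3,4) in \<open>auto intro: has_field_derivative_at_within\<close>)
  then show ?thesis by simp
qed

text \<open>For a unit direction the projected parameters are controlled by the norms of the means
  and covariances. The resulting constant is free of \<open>nu\<close>, which gives integrability
  over the sphere.\<close>

lemma C2sq_proj_mixture_cdf_bounded:
  fixes mu mu' :: "nat \<Rightarrow> real^'m"
  assumes p: "\<forall>i<n. p i \<ge> 0" "(\<Sum>i<n. p i) = 1" and p': "\<forall>k<n'. p' k \<ge> 0" "(\<Sum>k<n'. p' k) = 1"
    and pd: "\<And>i. i < n \<Longrightarrow> nu \<bullet> (Sg i *v nu) > 0" and pd': "\<And>k. k < n' \<Longrightarrow> nu \<bullet> (Sg' k *v nu) > 0"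
    and nu: "norm nu = 1"
  shows "\<bar>C2sq (proj_mixture_cdf p mu Sg n nu) (proj_mixture_cdf p' mu' Sg' n' nu)\<bar>
    \<le> ((\<Sum>i<n. p i * (1 + (norm (mu i))\<^sup>2 + norm (Sg i)))
        + (\<Sum>k<n'. p' k * (1 + (norm (mu' k))\<^sup>2 + norm (Sg' k)))) * (LINT x|lborel. 1 / (1 + x\<^sup>2))"
proof -
  have mom: "1 + (m \<bullet> nu)\<^sup>2 + nu \<bullet> (A *v nu) \<le> 1 + (norm m)\<^sup>2 + norm A" for m and A :: "real^'m^'m"
  proof -
    have "\<bar>m \<bullet> nu\<bar> \<le> norm m" using Cauchy_Schwarz_ineq2[of m nu] nu by simp
    then have "(m \<bullet> nu)\<^sup>2 \<le> (norm m)\<^sup>2" by (metis abs_ge_zero power2_abs power_mono)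
    moreover have "nu \<bullet> (A *v nu) \<le> norm A"
      using norm_cauchy_schwarz[of nu "A *v nu"] norm_matrix_vector_mult_le[of A nu] nu by simp
    ultimately show ?thesis by linarith
  qed
  let ?I = "LINT x|lborel. 1 / (1 + x\<^sup>2) :: real"
  have "?I \<ge> 0" by simp
  have "0 \<le> C2sq (proj_mixture_cdf p mu Sg n nu) (proj_mixture_cdf p' mu' Sg' n' nu)"
    by (simp add: C2sq_def)
  moreover have "C2sq (proj_mixture_cdf p mu Sg n nu) (proj_mixture_cdf p' mu' Sg' n' nu)
      \<le> ((\<Sum>i<n. p i * (1 + (mu i \<bullet> nu)\<^sup>2 + nu \<bullet> (Sg i *v nu)))
        + (\<Sum>k<n'. p' k * (1 + (mu' k \<bullet> nu)\<^sup>2 + nu \<bullet> (Sg' k *v nu)))) * ?I"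
    unfolding proj_mixture_cdf_eq_mixture_cdf by (rule C2sq_mixture_cdf(2)) (use p p' pd pd' in auto)
  moreover have "\<dots> \<le> ((\<Sum>i<n. p i * (1 + (norm (mu i))\<^sup>2 + norm (Sg i)))
        + (\<Sum>k<n'. p' k * (1 + (norm (mu' k))\<^sup>2 + norm (Sg' k)))) * ?I"
    using p(1) p'(1) by (intro mult_right_mono add_mono sum_mono mult_left_mono mom \<open>?I \<ge> 0\<close>) auto
  ultimately show ?thesis by linarith
qed

theorem theorem6:
  fixes p :: "nat \<Rightarrow> real" and mu :: "nat \<Rightarrow> real^'m" and S :: "nat \<Rightarrow> real^'m^'m"
    and n :: nat
    and p' :: "nat \<Rightarrow> real" and mu' :: "nat \<Rightarrow> real^'m" and Sg' :: "nat \<Rightarrow> real^'m^'m"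
    and n' :: nat and j :: nat
  assumes p_nonneg: "\<forall>i<n. p i \<ge> 0"
    and p_sum: "(\<Sum>i<n. p i) = 1"
    and S_inv: "\<forall>i<n. invertible (S i)"
    and p'_nonneg: "\<forall>k<n'. p' k \<ge> 0"
    and p'_sum: "(\<Sum>k<n'. p' k) = 1"
    and Sg'_sym: "\<forall>k<n'. transpose (Sg' k) = Sg' k"
    and Sg'_pd: "\<forall>k<n'. \<forall>x. x \<noteq> 0 \<longrightarrow> x \<bullet> (Sg' k *v x) > 0"
    and j: "j < n"
  defines "L \<equiv> (\<lambda>(M :: nat \<Rightarrow> real^'m) (T :: nat \<Rightarrow> real^'m^'m).
              S2sq p M (\<lambda>i. transpose (T i) ** T i) n p' mu' Sg' n')"
  shows "(\<exists>g. ((\<lambda>v. L (mu(j := v)) S) has_derivative (\<lambda>h. g \<bullet> h)) (at (mu j))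
              \<and> norm g \<le> 4 * sphere_area CARD('m))
       \<and> (\<exists>G. ((\<lambda>A. L mu (S(j := A))) has_derivative (\<lambda>H. G \<bullet> H)) (at (S j))
              \<and> norm G \<le> 4 * sphere_area CARD('m))"
proof -
  define F where "F M T nu = C2sq (proj_mixture_cdf p M (\<lambda>i. transpose (T i) ** T i) n nu)
    (proj_mixture_cdf p' mu' Sg' n' nu)" 
    for M and T :: "nat \<Rightarrow> real^'m^'m" and nu
  define V' where "V' = (\<lambda>(nu::real^'m) k. nu \<bullet> (Sg' k *v nu))"
  have L: "L M T = sphere_integral (F M T)" for M T
    by (simp add: L_def S2sq_def F_def[abs_def])
  have meas: "(\<lambda>w. F M T (w /\<^sub>R norm w)) \<in> borel_measurable borel" for M T
    unfolding F_def by (rule C2sq_proj_mixture_cdf_measurable)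
  have F_mixture: "F M T nu = C2sq (mixture_cdf p (\<lambda>i. M i \<bullet> nu) (\<lambda>i. (norm (T i *v nu))\<^sup>2) n)
      (mixture_cdf p' (\<lambda>k. mu' k \<bullet> nu) (V' nu) n')" for M T nu
    by (simp add: F_def V'_def proj_mixture_cdf_eq_mixture_cdf inner_gram_matrix_vector)
  have nz: "nu \<noteq> 0" if "norm nu = 1" for nu :: "real^'m" using that by auto
  have V': "\<forall>k<n'. V' nu k > 0" if "norm nu = 1" for nu
    using Sg'_pd nz[OF that] by (simp add: V'_def)
  have S_pos: "norm (S i *v nu) > 0" if "i < n" "norm nu = 1" for i nu
    using S_inv that(1) nz[OF that(2)] by (auto simp: invertible_left_inverse matrix_left_invertible_ker)
  have V: "\<forall>i<n. (norm (S i *v nu))\<^sup>2 > 0" if "norm nu = 1" for nu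
    using S_pos that by simp
  obtain B where bound: "\<And>nu. norm nu = 1 \<Longrightarrow> \<bar>F mu S nu\<bar> \<le> B"
    using C2sq_proj_mixture_cdf_bounded[OF p_nonneg p_sum p'_nonneg p'_sum,
        of _ "\<lambda>i. transpose (S i) ** S i" Sg' mu mu'] V V'
    unfolding F_def inner_gram_matrix_vector V'_def by blast
  \<comment> \<open>Each weight is at most 1, so the constant obtained is in fact at most 2.\<close>
  have pj: "2 * p j \<le> 4"
    using p_sum p_nonneg j sum_nonneg_leq_bound[of "{..<n}" p 1 j] by auto
  have area: "sphere_area CARD('m) \<ge> 0"
    by (simp flip: sphere_area_eq_ball_volume)
  have "\<exists>g. ((\<lambda>v. sphere_integral (F (mu(j := v)) S)) has_derivative (\<lambda>h. g \<bullet> h)) (at (mu j))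
      \<and> norm g \<le> (2 * p j) * sphere_area CARD('m)"
  \<comment> \<open>Moving a mean keeps all variances positive, so any radius would do here.\<close>
  proof (rule differentiable_sphere_integral[where \<delta> = 1 and B = B])
    fix nu :: "real^'m" assume nu: "norm nu = 1"
    let ?C = "\<lambda>t. C2sq (mixture_cdf p ((\<lambda>i. mu i \<bullet> nu)(j := t)) (\<lambda>i. (norm (S i *v nu))\<^sup>2) n)
      (mixture_cdf p' (\<lambda>k. mu' k \<bullet> nu) (V' nu) n')"
    have C: "F (mu(j := v)) S nu = ?C (v \<bullet> nu)" for v
      unfolding F_mixture by (intro arg_cong2[of _ _ _ _ C2sq] arg_cong[of _ _ "\<lambda>u. mixture_cdf p u _ n"]) auto
    have der: "\<exists>D. (?C has_real_derivative D) (at t) \<and> \<bar>D\<bar> \<le> 2 * p j" for t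
      using DERIV_C2sq_mixture_mean[OF p_nonneg p_sum p'_nonneg p'_sum V'[OF nu] j V[OF nu]] .
    show "\<bar>F (mu(j := mu j)) S nu\<bar> \<le> B" using bound[OF nu] by simp
    show "(\<lambda>v. F (mu(j := v)) S nu) differentiable at (mu j)"
      unfolding C
    proof (rule differentiable_compose[of ?C])
      show "?C differentiable at (mu j \<bullet> nu)"
        using der by (auto simp: real_differentiable_def)
    qed simp
    fix v
    have "\<bar>?C (v \<bullet> nu) - ?C (mu j \<bullet> nu)\<bar> \<le> 2 * p j * \<bar>v \<bullet> nu - mu j \<bullet> nu\<bar>"
      by (rule DERIV_bounded_imp_Lipschitz[OF convex_UNIV der]) auto
    also have "\<dots> \<le> 2 * p j * norm (v - mu j)"
      using Cauchy_Schwarz_ineq2[of "v - mu j" nu] nu p_nonneg j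
      by (intro mult_left_mono) (auto simp: inner_diff_left)
    finally show "\<bar>F (mu(j := v)) S nu - F (mu(j := mu j)) S nu\<bar> \<le> 2 * p j * norm (v - mu j)"
      unfolding C .
  qed (simp_all add: meas)
  moreover
  \<comment> \<open>As the radius for \<open>A\<close>, this lower bound of \<open>S j\<close> on
    unit vectors excludes every matrix that kills some direction.\<close>
  obtain c where c: "c > 0" "\<And>x. norm (S j *v x) \<ge> c * norm x"
    using linear_inj_bounded_below_pos[OF matrix_vector_mul_linear inj_matrix_vector_mult] S_inv j
    by metis
  have "\<exists>G. ((\<lambda>A. sphere_integral (F mu (S(j := A)))) has_derivative (\<lambda>H. G \<bullet> H)) (at (S j))
      \<and> norm G \<le> (2 * p j) * sphere_area CARD('m)"
  proof (rule differentiable_sphere_integral[where \<delta> = c and B = B])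
    fix nu :: "real^'m" assume nu: "norm nu = 1"
    let ?C = "\<lambda>s. C2sq (mixture_cdf p (\<lambda>i. mu i \<bullet> nu) ((\<lambda>i. (norm (S i *v nu))\<^sup>2)(j := s\<^sup>2)) n)
      (mixture_cdf p' (\<lambda>k. mu' k \<bullet> nu) (V' nu) n')"
    have C: "F mu (S(j := A)) nu = ?C (norm (A *v nu))" for A
      unfolding F_mixture by (intro arg_cong2[of _ _ _ _ C2sq] arg_cong[of _ _ "\<lambda>v. mixture_cdf p _ v n"]) auto
    have der: "\<exists>D. (?C has_real_derivative D) (at s) \<and> \<bar>D\<bar> \<le> 2 * p j" if "s > 0" for s
      using DERIV_C2sq_mixture_sd[OF p_nonneg p_sum p'_nonneg p'_sum V'[OF nu] j V[OF nu] that] .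
    show "\<bar>F mu (S(j := S j)) nu\<bar> \<le> B" using bound[OF nu] by simp
    have lin: "linear (\<lambda>A. A *v nu)" for nu :: "real^'m"
      by (intro linearI) (simp_all add: matrix_vector_mult_add_rdistrib scaleR_matrix_vector_assoc)
    show "(\<lambda>A. F mu (S(j := A)) nu) differentiable at (S j)"
      unfolding C
    proof (rule differentiable_compose[of ?C])
      show "?C differentiable at (norm (S j *v nu))"
        using der[OF S_pos[OF j nu]] by (auto simp: real_differentiable_def)
      show "(\<lambda>A. norm (A *v nu)) differentiable at (S j)"
        by (rule differentiable_compose[of norm])
          (use S_pos[OF j nu] lin in \<open>auto intro: linear_imp_differentiable\<close>)
    qed
    fix A assume A: "A \<in> ball (S j) c"
    have diff: "norm (A *v nu - S j *v nu) \<le> norm (A - S j)"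
      using norm_matrix_vector_mult_le[of "A - S j" nu] nu by (simp add: matrix_vector_mult_diff_rdistrib)
    \<comment> \<open>The perturbation is smaller than \<open>c\<close>, hence than
      \<open>norm (S j *v nu)\<close>. Thus both standard deviations lie in the convex set of
      positive reals, where the derivative bound holds.\<close>
    moreover have "norm (A - S j) < norm (S j *v nu)"
      using c(2)[of nu] nu A by (simp add: dist_norm norm_minus_commute)
    ultimately have "norm (A *v nu) > 0"
      using norm_triangle_sub[of "S j *v nu" "A *v nu"] norm_minus_commute[of "S j *v nu" "A *v nu"] by linarith
    then have "\<bar>?C (norm (A *v nu)) - ?C (norm (S j *v nu))\<bar>
        \<le> 2 * p j * \<bar>norm (A *v nu) - norm (S j *v nu)\<bar>"
      using S_pos[OF j nu] by (intro DERIV_bounded_imp_Lipschitz[OF convex_real_interval(3) der]) auto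
    also have "\<dots> \<le> 2 * p j * norm (A - S j)"
      using norm_triangle_ineq3[of "A *v nu" "S j *v nu"] diff p_nonneg j
      by (intro mult_left_mono) auto
    finally show "\<bar>F mu (S(j := A)) nu - F mu (S(j := S j)) nu\<bar> \<le> 2 * p j * norm (A - S j)"
      unfolding C .
  qed (use c meas in simp_all)
  ultimately show ?thesis
    unfolding L using mult_right_mono[OF pj area] by (meson order_trans)
qed

end
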